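(* Let $X$ be a complex Banach space and let $A$ be the generator of a $C_0$-semigroup $(T(t))_{t\ge0}$ on $X$. Suppose that $\sigma(A)\subseteq\mathbb{C}_-$ and that $M\colon\mathbb{R}_+\to(0,\infty)$ is a continuous non-decreasing function such that $M(s)\to\infty$ as $s\to\infty$ and $$\delta M(s)\le \sup_{|r|\le s}\frac{1}{\operatorname{dist}(ir,\sigma(A))}\le \sup_{|r|\le s}\|R(ir,A)\|\le M(s),\quad s\ge0,$$ for some constant $\delta\in(0,1]$. If $$\|T(t)A^{-1}\|=O\left(\frac{1}{M^{-1}(ct)}\right),\quad t\to\infty,$$ for some $c>0$, then $M$ has positive increase.
   Context: $\mathbb{R}_+=[0,\infty)$ and $\mathbb{C}_-=\{z\in\mathbb{C}:\operatorname{Re} z<0\}$. For a closed operator $A$, $\sigma(A)$ is its spectrum and $R(z,A)=(zI-A)^{-1}$ for $z\notin\sigma(A)$. The semigroup is not assumed to be bounded. Given $a\ge0$, a measurable function $M\colon[a,\infty)\to(0,\infty)$ has positive increase if there exist constants $\alpha>0$, $c\in(0,1]$ and $s_0\ge a$ with $s_0>0$ such that $M(\lambda s)/M(s)\ge c\lambda^\alpha$ for all $\lambda\ge1$ and $s\ge s_0$. For a continuous non-decreasing function $M\colon[a,\infty)\to(0,\infty)$ with $M(s)\to\infty$ as $s\to\infty$, $M^{-1}$ denotes its right-continuous right-inverse $M^{-1}(t)=\sup\{r\ge a: M(r)\le t\}$, $t\ge M(a)$. $f(t)=O(g(t))$, $t\to\infty$, means there is a constant $C>0$ with $f(t)\le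 Cg(t)$ for all sufficiently large $t$. *)

theory Defs
  imports "HOL-Analysis.Analysis" "HOL-Library.Landau_Symbols"
begin

text \<open>HOL-Analysis only has real Banach spaces; a complex Banach space is a real one together with a
  compatible complex scalar multiplication.  Unitality follows from \<open>scaleR_scaleC\<close>.\<close>

class complex_banach = banach +
  fixes scaleC :: "complex \<Rightarrow> 'a \<Rightarrow> 'a"  (infixr "*\<^sub>C" 75)
  assumes scaleC_add_right: "z *\<^sub>C (x + y) = z *\<^sub>C x + z *\<^sub>C y"
    and scaleC_add_left: "(z + w) *\<^sub>C x = z *\<^sub>C x + w *\<^sub>C x"
    and scaleC_scaleC: "z *\<^sub>C w *\<^sub>C x = (z * w) *\<^sub>C x"
    and scaleR_scaleC: "r *\<^sub>R x = complex_of_real r *\<^sub>C x"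
    and norm_scaleC: "norm (z *\<^sub>C x) = cmod z * norm x"

instantiation complex :: complex_banach
begin

definition scaleC_complex :: "complex \<Rightarrow> complex \<Rightarrow> complex"
  where "scaleC_complex z x = z * x"

instance
  by standard (simp_all add: scaleC_complex_def algebra_simps scaleR_conv_of_real norm_mult)

end

definition bounded_clinear :: "('a::complex_banach \<Rightarrow> 'a) \<Rightarrow> bool"
  where "bounded_clinear f \<longleftrightarrow> bounded_linear f \<and> (\<forall>z x. f (z *\<^sub>C x) = z *\<^sub>C f x)"

text \<open>Only the operators \<open>T t\<close> with \<open>t \<ge> 0\<close> are constrained.\<close>

definition C0_semigroup :: "(real \<Rightarrow> 'a::complex_banach \<Rightarrow> 'a) \<Rightarrow> bool"
  where "C0_semigroup T \<longleftrightarrow>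
    (\<forall>t\<ge>0. bounded_clinear (T t)) \<and>
    (\<forall>x. T 0 x = x) \<and>
    (\<forall>s\<ge>0. \<forall>t\<ge>0. \<forall>x. T (s + t) x = T s (T t x)) \<and>
    (\<forall>x. continuous_on {0..} (\<lambda>t. T t x))"

text \<open>An unbounded operator is given by its domain \<open>D\<close> and a function \<open>A\<close>, whose values outside
  \<open>D\<close> are irrelevant.\<close>

definition is_generator ::
    "'a::complex_banach set \<Rightarrow> ('a \<Rightarrow> 'a) \<Rightarrow> (real \<Rightarrow> 'a \<Rightarrow> 'a) \<Rightarrow> bool"
  where "is_generator D A T \<longleftrightarrow>
    D = {x. \<exists>y. ((\<lambda>h. (1 / h) *\<^sub>R (T h x - x)) \<longlongrightarrow> y) (at_right 0)} \<and>
    (\<forall>x\<in>D. ((\<lambda>h. (1 / h) *\<^sub>R (T h x - x)) \<longlongrightarrow> A x) (at_right 0))"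

text \<open>The inverse of an injective operator with domain \<open>D\<close> and range the whole space.\<close>

abbreviation op_inverse :: "'a::complex_banach set \<Rightarrow> ('a \<Rightarrow> 'a) \<Rightarrow> 'a \<Rightarrow> 'a"
  where "op_inverse D A \<equiv> inv_into D A"

definition resolvent :: "'a::complex_banach set \<Rightarrow> ('a \<Rightarrow> 'a) \<Rightarrow> complex \<Rightarrow> 'a \<Rightarrow> 'a"
  where "resolvent D A z = op_inverse D (\<lambda>x. z *\<^sub>C x - A x)"

definition spectrum :: "'a::complex_banach set \<Rightarrow> ('a \<Rightarrow> 'a) \<Rightarrow> complex set"
  where "spectrum D A =
    {z. \<not> (bij_betw (\<lambda>x. z *\<^sub>C x - A x) D UNIV \<and> bounded_clinear (resolvent D A z))}"

text \<open>In \<open>1 / infdist z (spectrum D A)\<close> an empty spectrum gives \<open>1 / 0 = 0\<close>, in agreement with the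
  convention that the distance to the empty set is infinite.\<close>

text \<open>A property of measurable functions \<open>M : [a, \<infinity>) \<rightarrow> (0, \<infinity>)\<close> with \<open>a \<ge> 0\<close>; values of \<open>M\<close> to the
  left of \<open>a\<close> play no role.\<close>

definition positive_increase :: "real \<Rightarrow> (real \<Rightarrow> real) \<Rightarrow> bool"
  where "positive_increase a M \<longleftrightarrow>
    (\<exists>\<alpha>>0. \<exists>c\<in>{0<..1}. \<exists>s\<^sub>0\<ge>a. s\<^sub>0 > 0 \<and>
      (\<forall>l\<ge>1. \<forall>s\<ge>s\<^sub>0. M (l * s) / M s \<ge> c * l powr \<alpha>))"

text \<open>Meaningful for \<open>t \<ge> M a\<close> and \<open>M\<close> tending to infinity: then the set is nonempty and bounded.\<close>

definition right_inverse :: "real \<Rightarrow> (real \<Rightarrow> real) \<Rightarrow> real \<Rightarrow> real"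
  where "right_inverse a M t = Sup {r. a \<le> r \<and> M r \<le> t}"

end

theory Submission
  imports Defs
begin

text \<open>If \<open>z \<in> \<sigma>(A)\<close> then \<open>exp (t z) / z\<close> belongs to the spectrum of \<open>T(t) A\<^sup>-\<^sup>1\<close>, so the decay assumption bounds
  \<open>M\<^sup>-\<^sup>1(c t)\<close> by a multiple of \<open>|z| exp (- t Re z)\<close>. The lower bound on \<open>1 / dist(ir, \<sigma>(A))\<close> provides
  such \<open>z\<close> with \<open>|z| \<le> 2 s\<close> and \<open>- Re z = O(1 / M(s))\<close>. For \<open>c t = 2 M(s)\<close> the exponential is then
  bounded, whence \<open>M\<^sup>-\<^sup>1(2 M(s)) = O(s)\<close>: \<open>M(L s) \<ge> 2 M(s)\<close> for some \<open>L > 1\<close> and all large \<open>s\<close>, and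
  iterating this doubling gives positive increase.\<close>

section \<open>Bounded complex-linear operators\<close>

lemma bounded_clinear_bounded_linear: "bounded_clinear f \<Longrightarrow> bounded_linear f"
  by (simp add: bounded_clinear_def)

lemma bounded_clinear_scaleC: "bounded_clinear f \<Longrightarrow> f (z *\<^sub>C x) = z *\<^sub>C f x"
  by (simp add: bounded_clinear_def)

lemmas bounded_clinear_add = linear_add[OF bounded_linear.linear[OF bounded_clinear_bounded_linear]]
lemmas bounded_clinear_diff = linear_diff[OF bounded_linear.linear[OF bounded_clinear_bounded_linear]]

lemma bounded_clinear_compose:
  "bounded_clinear f \<Longrightarrow> bounded_clinear g \<Longrightarrow> bounded_clinear (\<lambda>x. f (g x))"
  by (simp add: bounded_clinear_def bounded_linear_compose)

text \<open>This makes the product rules for continuity and differentiation available for integrands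
  of the form \<open>exp (of_real (t - s) * z) *\<^sub>C T s x\<close>.\<close>

lemma bounded_bilinear_scaleC:
  "bounded_bilinear (scaleC :: complex \<Rightarrow> 'a::complex_banach \<Rightarrow> 'a)"
proof
  fix z w :: complex and x y :: 'a and r :: real
  show "(z + w) *\<^sub>C x = z *\<^sub>C x + w *\<^sub>C x" "z *\<^sub>C (x + y) = z *\<^sub>C x + z *\<^sub>C y"
    by (simp_all add: scaleC_add_left scaleC_add_right)
  show "(r *\<^sub>R z) *\<^sub>C x = r *\<^sub>R z *\<^sub>C x" "z *\<^sub>C r *\<^sub>R x = r *\<^sub>R z *\<^sub>C x"
    by (simp_all add: scaleR_conv_of_real scaleR_scaleC[where 'a='a] scaleC_scaleC mult.commute)
  show "\<exists>K. \<forall>z x. norm (z *\<^sub>C x :: 'a) \<le> norm z * norm x * K"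
    by (rule exI[of _ 1]) (simp add: norm_scaleC)
qed

lemmas scaleC_diff_right = bounded_bilinear.diff_right[OF bounded_bilinear_scaleC]
lemmas scaleC_minus_left = bounded_bilinear.minus_left[OF bounded_bilinear_scaleC]
lemmas scaleC_zero_left = bounded_bilinear.zero_left[OF bounded_bilinear_scaleC]
lemmas bounded_linear_scaleC = bounded_bilinear.bounded_linear_right[OF bounded_bilinear_scaleC]

lemma scaleC_one: "1 *\<^sub>C (x :: 'a::complex_banach) = x"
  using scaleR_scaleC[of 1 x] by simp

lemma bounded_clinear_scaleC_const: "bounded_clinear (\<lambda>x. z *\<^sub>C x)"
  by (simp add: bounded_clinear_def bounded_linear_scaleC scaleC_scaleC mult.commute)

lemma bounded_clinear_fun_diff:
  "bounded_clinear f \<Longrightarrow> bounded_clinear g \<Longrightarrow> bounded_clinear (\<lambda>x. f x - g x)"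
  by (simp add: bounded_clinear_def bounded_linear_sub scaleC_diff_right)

section \<open>Uniform boundedness and inversion of \<open>\<mu> - B\<close>\<close>

lemma uniform_boundedness:
  fixes f :: "'i \<Rightarrow> 'a::banach \<Rightarrow> 'b::real_normed_vector"
  assumes lin: "\<And>i. i \<in> I \<Longrightarrow> bounded_linear (f i)"
    and bdd: "\<And>x. \<exists>b. \<forall>i\<in>I. norm (f i x) \<le> b"
  obtains K where "\<And>i x. i \<in> I \<Longrightarrow> norm (f i x) \<le> K * norm x"
proof -
  define F where "F n = {x. \<forall>i\<in>I. norm (f i x) \<le> real n}" for n
  have closedF: "closed (F n)" for n
  proof -
    have "F n = (\<Inter>i\<in>I. {x. norm (f i x) \<le> real n})"
      by (auto simp: F_def)
    then show ?thesis
      by (auto intro!: closed_INT closed_Collect_le continuous_intros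
          bounded_linear.continuous_on[OF lin])
  qed
  have "\<exists>n. x \<in> F n" for x
  proof -
    obtain b where b: "\<forall>i\<in>I. norm (f i x) \<le> b" using bdd by blast
    obtain n where "b \<le> real n" using real_arch_simple by blast
    then show ?thesis using b by (auto simp: F_def intro: order_trans)
  qed
  then have UN: "\<Union>(range F) = UNIV" by blast
  \<comment> \<open>By Baire, countably many closed sets with empty interior cannot cover the whole
    space.\<close>
  have "\<exists>n. interior (F n) \<noteq> {}"
  proof (rule ccontr)
    assume "\<not> ?thesis"
    then have "euclidean interior_of \<Union>(range F) = {}"
      using closedF
      by (intro Baire_category_alt) (auto simp: completely_metrizable_space_euclidean)
    then show False by (simp add: UN)
  qed
  then obtain n a where "a \<in> interior (F n)" by blast
  then obtain e where e: "e > 0" "cball a e \<subseteq> F n"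
    by (auto simp: mem_interior_cball)
  have "norm (f i x) \<le> (2 * real n / e) * norm x" if i: "i \<in> I" for i x
  proof (cases "x = 0")
    case True
    then show ?thesis using lin[OF i] by (simp add: linear_simps)
  next
    case False
    \<comment> \<open>Rescaling to norm \<open>e\<close> keeps \<open>a + y\<close> in the ball
      around \<open>a\<close>, so \<open>f i y\<close> is a difference of two values of norm at most
      \<open>n\<close>.\<close>
    define y where "y = (e / norm x) *\<^sub>R x"
    interpret bounded_linear "f i" by (rule lin[OF i])
    have "a + y \<in> F n" "a \<in> F n"
      using e False by (auto simp: y_def dist_norm subset_iff)
    then have "norm (f i (a + y)) \<le> real n" "norm (f i a) \<le> real n"
      using i by (auto simp: F_def)
    moreover have "norm (f i y) \<le> norm (f i (a + y)) + norm (f i a)"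
      by (metis add add_diff_cancel_left' norm_triangle_ineq4)
    ultimately have "norm (f i y) \<le> 2 * real n" by linarith
    moreover have "norm (f i y) = e / norm x * norm (f i x)"
      using e False by (simp add: y_def scaleR)
    ultimately show ?thesis using e False by (simp add: field_simps)
  qed
  then show thesis by (rule that)
qed

text \<open>The equation \<open>\<mu> *\<^sub>C x - B x = y\<close> says that \<open>x\<close> is a
  fixed point of \<open>(1 / \<mu>) *\<^sub>C (y + B x)\<close>, a contraction with constant
  \<open>onorm B / cmod \<mu>\<close>, so Banach's fixed point theorem solves it uniquely.\<close>

lemma bounded_clinear_inverse_shift:
  fixes B :: "'a::complex_banach \<Rightarrow> 'a"
  assumes B: "bounded_clinear B" and less: "onorm B < cmod \<mu>"
  obtains R where "bounded_clinear R" "\<And>x. R (\<mu> *\<^sub>C x - B x) = x"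
    "\<And>y. \<mu> *\<^sub>C R y - B (R y) = y"
proof -
  define P where "P x = \<mu> *\<^sub>C x - B x" for x
  note BL = bounded_clinear_bounded_linear[OF B]
  have P: "bounded_clinear P"
    unfolding P_def by (intro bounded_clinear_fun_diff bounded_clinear_scaleC_const B)
  have pos: "0 < cmod \<mu>" "0 \<le> onorm B"
    using less onorm_pos_le[OF BL] by auto
  then have \<mu>: "\<mu> \<noteq> 0" by auto
  have ex1: "\<exists>!x. P x = y" for y
  proof -
    define g where "g x = (1 / \<mu>) *\<^sub>C (y + B x)" for x
    have "dist (g u) (g v) \<le> (onorm B / cmod \<mu>) * dist u v" for u v
    proof -
      have "g u - g v = (1 / \<mu>) *\<^sub>C B (u - v)"
        by (simp add: g_def scaleC_diff_right[symmetric] bounded_clinear_diff[OF B])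
      then have "dist (g u) (g v) = norm (B (u - v)) / cmod \<mu>"
        by (simp add: dist_norm norm_scaleC norm_divide)
      also have "\<dots> \<le> onorm B * norm (u - v) / cmod \<mu>"
        by (intro divide_right_mono onorm[OF BL]) auto
      finally show ?thesis by (simp add: dist_norm)
    qed
    then have "\<exists>!x. g x = x"
      using pos less by (intro banach_fix_type[of "onorm B / cmod \<mu>"]) auto
    moreover have "g x = x \<longleftrightarrow> P x = y" for x
    proof -
      have "g x = x \<longleftrightarrow> \<mu> *\<^sub>C g x = \<mu> *\<^sub>C x"
        using \<mu> by (metis (no_types) divide_self_if scaleC_one scaleC_scaleC
            times_divide_eq_left mult_1)
      also have "\<mu> *\<^sub>C g x = y + B x" using \<mu> by (simp add: g_def scaleC_scaleC scaleC_one)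
      finally show ?thesis by (auto simp: P_def algebra_simps)
    qed
    ultimately show ?thesis by simp
  qed
  define R where "R y = (THE x. P x = y)" for y
  have PR: "P (R y) = y" for y
    unfolding R_def by (rule theI'[OF ex1])
  have RP: "R (P x) = x" for x
    using ex1 PR by metis
  \<comment> \<open>Take norms in \<open>\<mu> *\<^sub>C R y = y + B (R y)\<close> and absorb the
    last term on the left.\<close>
  have bnd: "norm (R y) \<le> norm y * (1 / (cmod \<mu> - onorm B))" for y
  proof -
    have "cmod \<mu> * norm (R y) = norm (y + B (R y))"
      using PR[of y] by (metis P_def diff_add_cancel norm_scaleC)
    also have "\<dots> \<le> norm y + onorm B * norm (R y)"
      using norm_triangle_ineq[of y "B (R y)"] onorm[OF BL, of "R y"] by linarith
    finally show ?thesis using less by (simp add: field_simps)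
  qed
  have scale: "R (z *\<^sub>C y) = z *\<^sub>C R y" for z y
    by (metis PR RP bounded_clinear_scaleC[OF P])
  have "bounded_linear R"
  proof (rule bounded_linear_intro)
    show "R (x + y) = R x + R y" for x y
      by (metis PR RP bounded_clinear_add[OF P])
    show "R (r *\<^sub>R x) = r *\<^sub>R R x" for r x
      by (simp add: scaleR_scaleC scale)
  qed (rule bnd)
  then have "bounded_clinear R"
    by (simp add: bounded_clinear_def scale)
  then show thesis using that RP PR by (simp add: P_def)
qed

section \<open>A doubling criterion for positive increase\<close>

text \<open>Multiplying the argument by \<open>L ^ n\<close> multiplies \<open>M\<close> by at least
  \<open>2 ^ n\<close>, which is growth of exponent \<open>log L 2\<close>; monotonicity fills the
  gaps between the powers of \<open>L\<close>.\<close>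

lemma positive_increase_of_doubling:
  assumes mono: "mono_on {0..} M" and pos: "\<And>s. s \<ge> 0 \<Longrightarrow> M s > 0"
    and L: "L > 1" and s0: "s\<^sub>0 > 0" and dbl: "\<And>s. s \<ge> s\<^sub>0 \<Longrightarrow> 2 * M s \<le> M (L * s)"
  shows "positive_increase 0 M"
proof -
  have iter: "2 ^ n * M s \<le> M (L ^ n * s)" if "s \<ge> s\<^sub>0" for n s
  proof (induction n)
    case (Suc n)
    have "1 * s\<^sub>0 \<le> L ^ n * s"
      using L s0 that by (intro mult_mono) auto
    then have "2 * M (L ^ n * s) \<le> M (L * (L ^ n * s))"
      by (intro dbl) simp
    with Suc show ?case by (simp add: mult.assoc)
  qed simp
  define \<alpha> where "\<alpha> = log L 2"
  have "1 / 2 * l powr \<alpha> \<le> M (l * s) / M s" if "l \<ge> 1" "s \<ge> s\<^sub>0" for l s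
  proof -
    \<comment> \<open>\<open>L ^ n\<close> is the largest power of \<open>L\<close> not exceeding
      \<open>l\<close>. Since \<open>l powr \<alpha> = 2 powr log L l\<close>, rounding the exponent
      down loses at most a factor 2, hence the constant 1/2.\<close>
    define n where "n = nat \<lfloor>log L l\<rfloor>"
    have log0: "log L l \<ge> 0" using L that by simp
    then have n: "real n \<le> log L l" "log L l < real n + 1"
      by (auto simp: n_def)
    have "L ^ n = L powr real n" using L by (simp add: powr_realpow)
    also have "\<dots> \<le> L powr log L l" using L n by (intro powr_mono) auto
    also have "\<dots> = l" using L that by simp
    finally have "L ^ n * s \<le> l * s" using that s0 by simp
    then have "M (L ^ n * s) \<le> M (l * s)"
      using that s0 L by (intro mono_onD[OF mono]) auto
    then have M1: "2 ^ n * M s \<le> M (l * s)" using iter[OF that(2), of n] by simp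
    have "l powr \<alpha> = 2 powr log L l"
      using L that by (simp add: \<alpha>_def log_def powr_def)
    also have "\<dots> \<le> 2 powr (real n + 1)" using n by (intro powr_mono) auto
    also have "\<dots> = 2 * 2 ^ n" by (simp add: powr_add powr_realpow)
    finally have "1 / 2 * l powr \<alpha> * M s \<le> 2 ^ n * M s"
      using pos[of s] s0 that by (intro mult_right_mono) auto
    with M1 have "1 / 2 * l powr \<alpha> * M s \<le> M (l * s)" by linarith
    then show ?thesis using pos[of s] s0 that by (simp add: pos_le_divide_eq)
  qed
  moreover have "\<alpha> > 0" using L by (simp add: \<alpha>_def)
  ultimately show ?thesis
    unfolding positive_increase_def using s0
    by (intro exI[of _ \<alpha>] conjI bexI[of _ "1/2"] exI[of _ s\<^sub>0]) auto
qed

section \<open>Semigroup orbits and the generator\<close>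

lemma C0_semigroup_bounded_clinear: "C0_semigroup T \<Longrightarrow> 0 \<le> t \<Longrightarrow> bounded_clinear (T t)"
  by (simp add: C0_semigroup_def)

lemma C0_semigroup_add: "C0_semigroup T \<Longrightarrow> 0 \<le> s \<Longrightarrow> 0 \<le> t \<Longrightarrow> T (s + t) x = T s (T t x)"
  by (simp add: C0_semigroup_def)

lemma C0_semigroup_continuous_on:
  "C0_semigroup T \<Longrightarrow> S \<subseteq> {0..} \<Longrightarrow> continuous_on S (\<lambda>t. T t x)"
  by (auto simp: C0_semigroup_def intro: continuous_on_subset)

lemma is_generatorD:
  "is_generator D A T \<Longrightarrow> x \<in> D \<Longrightarrow> ((\<lambda>h. (1 / h) *\<^sub>R (T h x - x)) \<longlongrightarrow> A x) (at_right 0)"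
  by (simp add: is_generator_def)

lemma is_generatorI:
  assumes "is_generator D A T" "((\<lambda>h. (1 / h) *\<^sub>R (T h x - x)) \<longlongrightarrow> y) (at_right 0)"
  shows "x \<in> D \<and> A x = y"
  using assms tendsto_unique[OF trivial_limit_at_right_real]
  unfolding is_generator_def by blast

text \<open>Each orbit is continuous, hence bounded on the compact interval; uniform boundedness
  makes the constant independent of \<open>x\<close>.\<close>

lemma C0_semigroup_bound:
  assumes T: "C0_semigroup T"
  obtains K where "K > 0" "\<And>s x. 0 \<le> s \<Longrightarrow> s \<le> t \<Longrightarrow> norm (T s x) \<le> K * norm x"
proof -
  obtain K where K: "\<And>s x. s \<in> {0..t} \<Longrightarrow> norm (T s x) \<le> K * norm x"
  proof (rule uniform_boundedness[of "{0..t}" T])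
    show "bounded_linear (T s)" if "s \<in> {0..t}" for s
      using that T by (simp add: C0_semigroup_bounded_clinear bounded_clinear_bounded_linear)
    show "\<exists>b. \<forall>s\<in>{0..t}. norm (T s x) \<le> b" for x
    proof -
      have "bounded ((\<lambda>s. T s x) ` {0..t})"
        by (intro compact_imp_bounded compact_continuous_image C0_semigroup_continuous_on[OF T]) auto
      then show ?thesis by (auto simp: bounded_iff)
    qed
  qed blast
  have "norm (T s x) \<le> (\<bar>K\<bar> + 1) * norm x" if "0 \<le> s" "s \<le> t" for s x
    by (rule order_trans[OF K mult_right_mono]) (use that in auto)
  then show thesis by (rule that[rotated]) auto
qed

text \<open>Since \<open>T s\<close> and \<open>T h\<close> commute, the difference quotient at
  \<open>T s x\<close> is the image under \<open>T s\<close> of the one at \<open>x\<close>, and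
  \<open>T s\<close> is continuous.\<close>

lemma generator_orbit:
  assumes T: "C0_semigroup T" and G: "is_generator D A T" and x: "x \<in> D" and s: "0 \<le> s"
  shows "T s x \<in> D \<and> A (T s x) = T s (A x)"
proof (rule is_generatorI[OF G])
  interpret bounded_linear "T s"
    by (intro bounded_clinear_bounded_linear C0_semigroup_bounded_clinear[OF T] s)
  have "((\<lambda>h. T s ((1 / h) *\<^sub>R (T h x - x))) \<longlongrightarrow> T s (A x)) (at_right 0)"
    by (intro tendsto is_generatorD[OF G x])
  moreover have "\<forall>\<^sub>F h in at_right 0. T s ((1 / h) *\<^sub>R (T h x - x)) = (1 / h) *\<^sub>R (T h (T s x) - T s x)"
    using eventually_at_right_less
  proof eventually_elim
    case (elim h)
    then show ?case
      using C0_semigroup_add[OF T s, of h] C0_semigroup_add[OF T _ s, of h]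
      by (simp add: scaleR diff add.commute)
  qed
  ultimately show "((\<lambda>h. (1 / h) *\<^sub>R (T h (T s x) - T s x)) \<longlongrightarrow> T s (A x)) (at_right 0)"
    by (rule Lim_transform_eventually)
qed

text \<open>The generator only gives a right derivative at 0. Increments in both directions reduce
  to it by starting from the earlier of the two times, with the operator bound and the continuity of
  \<open>T s (A x)\<close> controlling the error.\<close>

lemma orbit_has_vector_derivative:
  assumes T: "C0_semigroup T" and G: "is_generator D A T" and x: "x \<in> D" and s: "s \<in> {0..t}"
  shows "((\<lambda>s. T s x) has_vector_derivative T s (A x)) (at s within {0..t})"
  unfolding has_vector_derivative_def has_derivative_within_alt
proof (intro conjI allI impI bounded_linear_scaleR_left)
  fix e :: real assume e: "e > 0"
  obtain K where K: "K > 0" "\<And>s x. 0 \<le> s \<Longrightarrow> s \<le> t \<Longrightarrow> norm (T s x) \<le> K * norm x"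
    by (rule C0_semigroup_bound[OF T, of t]) blast
  \<comment> \<open>Half of \<open>e\<close> goes to the remainder at 0, which is later multiplied
    by \<open>K\<close>; the other half goes to continuity.\<close>
  have "\<forall>\<^sub>F h in at_right 0. dist ((1 / h) *\<^sub>R (T h x - x)) (A x) < e / (2 * K)"
    using K e by (intro tendstoD[OF is_generatorD[OF G x]]) auto
  then obtain d1 where d1: "d1 > 0"
    "\<And>h. 0 < h \<Longrightarrow> h < d1 \<Longrightarrow> dist ((1 / h) *\<^sub>R (T h x - x)) (A x) < e / (2 * K)"
    by (auto simp: eventually_at_right_field)
  have step: "norm (T h x - x - h *\<^sub>R A x) \<le> e / (2 * K) * h" if "0 \<le> h" "h < d1" for h
  proof (cases "h = 0")
    case True
    then show ?thesis using T by (simp add: C0_semigroup_def)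
  next
    case False
    then have h: "h > 0" using that by simp
    have "T h x - x - h *\<^sub>R A x = h *\<^sub>R ((1 / h) *\<^sub>R (T h x - x) - A x)"
      using h by (simp add: scaleR_diff_right)
    then have "norm (T h x - x - h *\<^sub>R A x) = h * dist ((1 / h) *\<^sub>R (T h x - x)) (A x)"
      using h by (simp add: dist_norm)
    also have "\<dots> \<le> h * (e / (2 * K))"
      using d1(2)[of h] h that by (intro mult_left_mono) auto
    finally show ?thesis by (simp only: mult.commute)
  qed
  have "continuous_on {0..t} (\<lambda>s. T s (A x))"
    by (intro C0_semigroup_continuous_on[OF T]) auto
  then obtain d2 where d2: "d2 > 0"
    "\<And>y. y \<in> {0..t} \<Longrightarrow> dist y s < d2 \<Longrightarrow> dist (T y (A x)) (T s (A x)) < e / 2"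
    using s e unfolding continuous_on_iff by (meson half_gt_zero)
  show "\<exists>d>0. \<forall>y\<in>{0..t}. norm (y - s) < d \<longrightarrow>
      norm (T y x - T s x - (y - s) *\<^sub>R T s (A x)) \<le> e * norm (y - s)"
  proof (intro exI[of _ "min d1 d2"] conjI ballI impI)
    fix y assume y: "y \<in> {0..t}" "norm (y - s) < min d1 d2"
    define m h where "m = min y s" and "h = \<bar>y - s\<bar>"
    define r where "r = T h x - x - h *\<^sub>R A x"
    have h: "0 \<le> h" "h < d1" and m: "0 \<le> m" "m \<le> t" "m \<in> {0..t}" "dist m s < d2"
      using y s d2(1) by (cases "y \<le> s"; auto simp: h_def m_def dist_real_def)+
    interpret bounded_linear "T m"
      by (intro bounded_clinear_bounded_linear C0_semigroup_bounded_clinear[OF T] m)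
    have "norm (T m r) \<le> K * norm r" using K(2) m by blast
    also have "\<dots> \<le> K * (e / (2 * K) * h)"
      unfolding r_def using step[OF h] K(1) by (intro mult_left_mono) auto
    also have "\<dots> = e / 2 * h" using K(1) by simp
    finally have 1: "norm (T m r) \<le> e / 2 * h" .
    have "norm (T m (A x) - T s (A x)) \<le> e / 2"
      using d2(2)[OF m(3,4)] by (simp add: dist_norm)
    then have "h * norm (T m (A x) - T s (A x)) \<le> h * (e / 2)"
      using h(1) by (rule mult_left_mono)
    then have 2: "norm (h *\<^sub>R (T m (A x) - T s (A x))) \<le> e / 2 * h"
      using h(1) by (simp add: mult.commute)
    \<comment> \<open>The remainder at 0 is transported to time \<open>m\<close>; it still contains
      \<open>T m (A x)\<close>, which is then exchanged for \<open>T s (A x)\<close>.\<close>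
    have Tr: "T m r = T (m + h) x - T m x - h *\<^sub>R T m (A x)"
      using C0_semigroup_add[OF T m(1) h(1)] by (simp add: r_def diff scaleR)
    have "norm (T y x - T s x - (y - s) *\<^sub>R T s (A x))
        = norm (T m r + h *\<^sub>R (T m (A x) - T s (A x)))"
    proof (cases "s \<le> y")
      case True
      then have "m = s" "m + h = y" "y - s = h" by (simp_all add: m_def h_def)
      then show ?thesis unfolding Tr by (simp only:) (simp add: scaleR_diff_right)
    next
      case False
      then have "m = y" "m + h = s" "y - s = - h" by (simp_all add: m_def h_def)
      then have "T y x - T s x - (y - s) *\<^sub>R T s (A x)
          = - (T m r + h *\<^sub>R (T m (A x) - T s (A x)))"
        unfolding Tr by (simp only:) (simp add: scaleR_diff_right)
      then show ?thesis by (simp only: norm_minus_cancel)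
    qed
    also have "\<dots> \<le> e * h"
      using norm_triangle_ineq[of "T m r" "h *\<^sub>R (T m (A x) - T s (A x))"] 1 2 by linarith
    finally show "norm (T y x - T s x - (y - s) *\<^sub>R T s (A x)) \<le> e * norm (y - s)"
      by (simp add: h_def)
  qed (use d1 d2 in auto)
qed

section \<open>The convolution of an exponential with an orbit\<close>

definition twisted_integral ::
    "(real \<Rightarrow> 'a::complex_banach \<Rightarrow> 'a) \<Rightarrow> complex \<Rightarrow> real \<Rightarrow> 'a \<Rightarrow> 'a"
  where "twisted_integral T z t x = integral {0..t} (\<lambda>s. exp (of_real (t - s) * z) *\<^sub>C T s x)"

lemma twisted_continuous_on:
  assumes "C0_semigroup T"
  shows "continuous_on {0..t} (\<lambda>s. exp (of_real (t - s) * z) *\<^sub>C T s x)"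
  by (intro bounded_bilinear.continuous_on[OF bounded_bilinear_scaleC] continuous_intros
      C0_semigroup_continuous_on[OF assms]) auto

lemma twisted_integrable_on:
  assumes "C0_semigroup T"
  shows "(\<lambda>s. exp (of_real (t - s) * z) *\<^sub>C T s x) integrable_on {0..t}"
  by (intro integrable_continuous_real twisted_continuous_on assms)

text \<open>Serves twice: with \<open>J\<close> a scalar multiplication for complex homogeneity, and
  with \<open>J\<close> the inverse of the generator.\<close>

lemma twisted_integral_commute:
  assumes T: "C0_semigroup T" and J: "bounded_clinear J"
    and comm: "\<And>s x. 0 \<le> s \<Longrightarrow> J (T s x) = T s (J x)"
  shows "J (twisted_integral T z t x) = twisted_integral T z t (J x)"
proof -
  have "J (twisted_integral T z t x) = integral {0..t} (J \<circ> (\<lambda>s. exp (of_real (t - s) * z) *\<^sub>C T s x))"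
    unfolding twisted_integral_def
    by (intro integral_linear[symmetric] twisted_integrable_on T bounded_clinear_bounded_linear J)
  also have "\<dots> = twisted_integral T z t (J x)"
    unfolding twisted_integral_def
    by (intro integral_cong) (simp add: bounded_clinear_scaleC[OF J] comm)
  finally show ?thesis .
qed

lemma bounded_clinear_twisted_integral:
  assumes T: "C0_semigroup T" and t: "0 \<le> t"
  shows "bounded_clinear (twisted_integral T z t)"
proof -
  have scale: "twisted_integral T z t (w *\<^sub>C x) = w *\<^sub>C twisted_integral T z t x" for w x
    by (rule twisted_integral_commute[OF T bounded_clinear_scaleC_const, symmetric])
      (simp add: bounded_clinear_scaleC[OF C0_semigroup_bounded_clinear[OF T]])
  obtain K where K: "K > 0" "\<And>s x. 0 \<le> s \<Longrightarrow> s \<le> t \<Longrightarrow> norm (T s x) \<le> K * norm x"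
    by (rule C0_semigroup_bound[OF T, of t]) blast
  have "bounded ((\<lambda>s. exp (of_real (t - s) * z)) ` {0..t})"
    by (intro compact_imp_bounded compact_continuous_image continuous_intros) auto
  then obtain L where L: "L > 0" "\<And>s. s \<in> {0..t} \<Longrightarrow> cmod (exp (of_real (t - s) * z)) \<le> L"
    by (auto simp: bounded_pos)
  have "bounded_linear (twisted_integral T z t)"
  proof (rule bounded_linear_intro)
    show "twisted_integral T z t (x + y) = twisted_integral T z t x + twisted_integral T z t y" for x y
      unfolding twisted_integral_def
      by (subst integral_add[OF twisted_integrable_on[OF T] twisted_integrable_on[OF T], symmetric])
        (auto intro!: integral_cong
          simp: bounded_clinear_add[OF C0_semigroup_bounded_clinear[OF T]] scaleC_add_right)
    show "twisted_integral T z t (r *\<^sub>R x) = r *\<^sub>R twisted_integral T z t x" for r x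
      by (simp add: scaleR_scaleC scale)
    show "norm (twisted_integral T z t x) \<le> norm x * (L * K * t)" for x
    proof -
      have "norm (exp (of_real (t - s) * z) *\<^sub>C T s x) \<le> L * (K * norm x)" if "s \<in> {0..t}" for s
        unfolding norm_scaleC using that L K by (intro mult_mono) auto
      then have "norm (twisted_integral T z t x) \<le> L * (K * norm x) * (t - 0)"
        unfolding twisted_integral_def
        by (intro integral_bound twisted_continuous_on T t)
      then show ?thesis by (simp add: mult_ac)
    qed
  qed
  then show ?thesis by (simp add: bounded_clinear_def scale)
qed

text \<open>The integrand is minus the derivative of
  \<open>exp (of_real (t - s) * z) *\<^sub>C T s x\<close> in \<open>s\<close>, so the fundamental
  theorem of calculus leaves only the values at 0 and \<open>t\<close>.\<close>

lemma twisted_integral_generator: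
  assumes T: "C0_semigroup T" and G: "is_generator D A T" and x: "x \<in> D" and t: "0 \<le> t"
  shows "twisted_integral T z t (z *\<^sub>C x - A x) = exp (of_real t * z) *\<^sub>C x - T t x"
proof -
  have "((\<lambda>s. exp (of_real (t - s) * z) *\<^sub>C T s x) has_vector_derivative
      exp (of_real (t - s) * z) *\<^sub>C T s (A x) + (- z * exp (of_real (t - s) * z)) *\<^sub>C T s x)
      (at s within {0..t})" if s: "s \<in> {0..t}" for s
  proof (rule bounded_bilinear.has_vector_derivative[OF bounded_bilinear_scaleC])
    show "((\<lambda>s. exp (of_real (t - s) * z)) has_vector_derivative
        - z * exp (of_real (t - s) * z)) (at s within {0..t})"
      \<comment> \<open>This exposes the exponential as a holomorphic function of
        \<open>of_real s\<close>, so that its complex derivative can be restricted to the real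
        line.\<close>
      unfolding of_real_diff
      by (rule has_vector_derivative_real_field[where f = "\<lambda>w. exp ((of_real t - w) * z)"])
        (auto intro!: derivative_eq_intros)
  qed (rule orbit_has_vector_derivative[OF T G x s])
  from fundamental_theorem_of_calculus[OF t this]
  have "((\<lambda>s. exp (of_real (t - s) * z) *\<^sub>C T s (A x) + (- z * exp (of_real (t - s) * z)) *\<^sub>C T s x)
      has_integral T t x - exp (of_real t * z) *\<^sub>C x) {0..t}"
    using T by (simp add: scaleC_one C0_semigroup_def)
  from has_integral_neg[OF this]
  have "((\<lambda>s. - (exp (of_real (t - s) * z) *\<^sub>C T s (A x) + (- z * exp (of_real (t - s) * z)) *\<^sub>C T s x))
      has_integral exp (of_real t * z) *\<^sub>C x - T t x) {0..t}"
    by simp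
  moreover have "- (exp (of_real (t - s) * z) *\<^sub>C T s (A x) + (- z * exp (of_real (t - s) * z)) *\<^sub>C T s x)
      = exp (of_real (t - s) * z) *\<^sub>C T s (z *\<^sub>C x - A x)" if "s \<in> {0..t}" for s
    using that C0_semigroup_bounded_clinear[OF T, of s]
    by (simp add: bounded_clinear_diff bounded_clinear_scaleC scaleC_diff_right scaleC_minus_left
        scaleC_scaleC mult.commute)
  ultimately have "((\<lambda>s. exp (of_real (t - s) * z) *\<^sub>C T s (z *\<^sub>C x - A x))
      has_integral exp (of_real t * z) *\<^sub>C x - T t x) {0..t}"
    by (rule has_integral_eq[rotated])
  then show ?thesis
    unfolding twisted_integral_def by (rule integral_unique)
qed

section \<open>Spectral inclusion for the semigroup composed with the inverse generator\<close>

lemma not_in_spectrumI: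
  assumes left: "\<And>x. x \<in> D \<Longrightarrow> R (z *\<^sub>C x - A x) = x"
    and right: "\<And>y. R y \<in> D \<and> z *\<^sub>C R y - A (R y) = y" and R: "bounded_clinear R"
  shows "z \<notin> spectrum D A"
proof -
  have bb: "bij_betw (\<lambda>x. z *\<^sub>C x - A x) D UNIV"
    by (rule bij_betwI[where g = R]) (use assms in auto)
  then have "resolvent D A z y = R y" for y
    unfolding resolvent_def using right by (intro inv_into_f_eq) (auto simp: bij_betw_def)
  then have "resolvent D A z = R" by (rule ext)
  with bb R show ?thesis by (simp add: spectrum_def)
qed

text \<open>The resolvent at 0 inverts \<open>- A\<close>; composing with negation carries
  bijectivity and boundedness over to \<open>A\<close>.\<close>

lemma zero_not_in_spectrumD:
  assumes "0 \<notin> spectrum D A"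
  shows "bounded_clinear (op_inverse D A)"
    and "\<And>x. x \<in> D \<Longrightarrow> op_inverse D A (A x) = x"
    and "\<And>y. op_inverse D A y \<in> D" and "\<And>y. A (op_inverse D A y) = y"
proof -
  have bij: "bij_betw (\<lambda>x. - A x) D UNIV" and R: "bounded_clinear (resolvent D A 0)"
    using assms by (simp_all add: spectrum_def scaleC_zero_left)
  have bij: "bij_betw A D UNIV"
    using bij_betw_trans[OF bij, of uminus UNIV] by (simp add: o_def bij_uminus)
  then show 1: "\<And>x. x \<in> D \<Longrightarrow> op_inverse D A (A x) = x"
    by (simp add: bij_betw_inv_into_left)
  show 2: "\<And>y. op_inverse D A y \<in> D" and 3: "\<And>y. A (op_inverse D A y) = y"
    using bij by (simp_all add: bij_betw_def inv_into_into f_inv_into_f)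
  have "resolvent D A 0 y = op_inverse D A (- y)" for y
    unfolding resolvent_def using bij 1 2 3
    by (intro inv_into_f_eq) (auto simp: scaleC_zero_left bij_betw_def inj_on_def)
  then have "op_inverse D A = (\<lambda>y. resolvent D A 0 ((-1) *\<^sub>C y))"
    by (simp add: fun_eq_iff scaleC_minus_left scaleC_one)
  then show "bounded_clinear (op_inverse D A)"
    using bounded_clinear_compose[OF R bounded_clinear_scaleC_const] by metis
qed

text \<open>With \<open>\<mu> = exp (t z) / z\<close>, \<open>J = A\<^sup>-\<^sup>1\<close> and \<open>B = T t J\<close>, the operator \<open>Q = J (E - \<mu>)\<close> built from the
  twisted integral \<open>E\<close> satisfies \<open>(z - A) Q = \<mu> - B\<close> and \<open>Q (z - A) = \<mu> - B\<close> on \<open>D\<close>, so \<open>z - A\<close> is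
  invertible as soon as \<open>\<mu> - B\<close> is.\<close>

lemma spectral_inclusion:
  assumes T: "C0_semigroup T" and G: "is_generator D A T" and zero: "0 \<notin> spectrum D A"
    and z: "z \<in> spectrum D A" and t: "0 \<le> t"
  shows "cmod (exp (of_real t * z) / z) \<le> onorm (T t \<circ> op_inverse D A)"
proof (rule ccontr)
  assume neg: "\<not> ?thesis"
  define J where "J = op_inverse D A"
  define E where "E = twisted_integral T z t"
  define \<mu> where "\<mu> = exp (of_real t * z) / z"
  define Q where "Q w = J (E w - \<mu> *\<^sub>C w)" for w
  define B where "B x = T t (J x)" for x
  note J = zero_not_in_spectrumD[OF zero, folded J_def]
  have "z \<noteq> 0" using z zero by auto
  then have \<mu>z: "\<mu> * z = exp (of_real t * z)" "z * \<mu> = exp (of_real t * z)" by (simp_all add: \<mu>_def)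
  \<comment> \<open>Apply \<open>J\<close> to
    \<open>A (T s (J x)) = T s (A (J x)) = T s x\<close>.\<close>
  have comm: "J (T s x) = T s (J x)" if "0 \<le> s" for s x
    using generator_orbit[OF T G J(3) that, of x] J(2,4) by metis
  have E: "bounded_clinear E"
    unfolding E_def by (rule bounded_clinear_twisted_integral[OF T t])
  have Egen: "E (z *\<^sub>C x - A x) = exp (of_real t * z) *\<^sub>C x - T t x" if "x \<in> D" for x
    unfolding E_def by (rule twisted_integral_generator[OF T G that t])
  have JE: "J (E x) = E (J x)" for x
    unfolding E_def by (rule twisted_integral_commute[OF T J(1) comm])
  have Tt: "bounded_clinear (T t)" by (rule C0_semigroup_bounded_clinear[OF T t])
  have B: "bounded_clinear B"
    unfolding B_def by (rule bounded_clinear_compose[OF Tt J(1)])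
  have Q: "bounded_clinear Q"
    unfolding Q_def
    by (intro bounded_clinear_compose[OF J(1)] bounded_clinear_fun_diff E bounded_clinear_scaleC_const)
  have "B = T t \<circ> op_inverse D A" by (simp add: fun_eq_iff B_def J_def)
  then have "onorm B < cmod \<mu>" using neg by (simp add: \<mu>_def)
  then obtain R where R: "bounded_clinear R" "\<And>x. R (\<mu> *\<^sub>C x - B x) = x"
    "\<And>y. \<mu> *\<^sub>C R y - B (R y) = y"
    using bounded_clinear_inverse_shift[OF B] by blast
  \<comment> \<open>The exponential term produced by \<open>E\<close> cancels against
    \<open>(\<mu> * z) *\<^sub>C x\<close>.\<close>
  have Q1: "Q (z *\<^sub>C x - A x) = \<mu> *\<^sub>C x - B x" if "x \<in> D" for x
  proof -
    have "Q (z *\<^sub>C x - A x) = J (E (z *\<^sub>C x - A x) - (\<mu> * z) *\<^sub>C x + \<mu> *\<^sub>C A x)"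
      by (simp add: Q_def scaleC_diff_right scaleC_scaleC diff_diff_eq2 diff_add_eq)
    also have "\<dots> = J (\<mu> *\<^sub>C A x - T t x)"
      by (simp add: Egen[OF that] \<mu>z)
    also have "\<dots> = \<mu> *\<^sub>C x - B x"
      by (simp add: bounded_clinear_diff[OF J(1)] bounded_clinear_scaleC[OF J(1)] J(2)[OF that]
          comm[OF t] B_def)
    finally show ?thesis .
  qed
  have Q2: "z *\<^sub>C Q w - A (Q w) = \<mu> *\<^sub>C w - B w" for w
  proof -
    have "A (Q w) = E w - \<mu> *\<^sub>C w" by (simp only: Q_def J(4))
    then have "z *\<^sub>C Q w - A (Q w) = z *\<^sub>C J (E w) - (z * \<mu>) *\<^sub>C J w - (E w - \<mu> *\<^sub>C w)"
      by (simp add: Q_def bounded_clinear_diff[OF J(1)] bounded_clinear_scaleC[OF J(1)]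
          scaleC_diff_right scaleC_scaleC)
    also have "\<dots> = E (z *\<^sub>C J w - A (J w)) - (z * \<mu>) *\<^sub>C J w + \<mu> *\<^sub>C w"
      by (simp add: JE J(4) bounded_clinear_diff[OF E] bounded_clinear_scaleC[OF E])
    also have "\<dots> = \<mu> *\<^sub>C w - B w"
      by (simp add: Egen[OF J(3)] \<mu>z B_def)
    finally show ?thesis .
  qed
  have QD: "Q w \<in> D" for w
    unfolding Q_def by (rule J(3))
  \<comment> \<open>By \<open>Q1\<close> and \<open>Q2\<close>, \<open>Q\<close> commutes with
    \<open>\<mu> - B\<close> and hence with \<open>R\<close>. Thus the left inverse
    \<open>R Q\<close> and the right inverse \<open>Q R\<close> of \<open>z - A\<close> agree, and
    their values lie in \<open>D\<close>.\<close>
  have QR: "Q (R y) = R (Q y)" for y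
    using Q1[OF QD, of "R y"] by (metis Q2 R(2,3))
  have "z \<notin> spectrum D A"
  proof (rule not_in_spectrumI[where R = "\<lambda>y. R (Q y)"])
    show "R (Q (z *\<^sub>C x - A x)) = x" if "x \<in> D" for x
      by (simp add: Q1[OF that] R(2))
    show "R (Q y) \<in> D \<and> z *\<^sub>C R (Q y) - A (R (Q y)) = y" for y
      unfolding QR[symmetric] by (simp add: Q2 R(3) QD)
  qed (rule bounded_clinear_compose[OF R(1) Q])
  with z show False by contradiction
qed

section \<open>From spectral bounds to the growth of \<open>M\<close>\<close>

text \<open>The scalar half of the argument: \<open>B t\<close> stands for the norm of the semigroup
  composed with the inverse generator, and the semigroup enters only through the spectral inclusion
  bound.\<close>

lemma positive_increase_of_spectrum:
  fixes \<sigma> :: "complex set"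
  assumes mono: "mono_on {0..} M" and pos: "\<And>s. s \<ge> 0 \<Longrightarrow> M s > 0"
    and lim: "filterlim M at_top at_top" and \<delta>: "0 < \<delta>" and c: "c > 0"
    and low: "\<And>s. s \<ge> 0 \<Longrightarrow>
      \<delta> * M s \<le> (SUP r\<in>{r. \<bar>r\<bar> \<le> s}. 1 / infdist (\<i> * complex_of_real r) \<sigma>)"
    and B: "\<And>t z. t \<ge> 0 \<Longrightarrow> z \<in> \<sigma> \<Longrightarrow> cmod (exp (of_real t * z) / z) \<le> B t"
    and nz: "0 \<notin> \<sigma>"
    and O: "B \<in> O[at_top](\<lambda>t. 1 / right_inverse 0 M (c * t))"
  shows "positive_increase 0 M"
proof -
  obtain C where C: "C > 0" "\<forall>\<^sub>F t in at_top. norm (B t) \<le> C * norm (1 / right_inverse 0 M (c * t))"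
    using landau_o.bigE[OF O] by blast
  then obtain t\<^sub>0 where t0: "\<And>t. t \<ge> t\<^sub>0 \<Longrightarrow> norm (B t) \<le> C * norm (1 / right_inverse 0 M (c * t))"
    by (auto simp: eventually_at_top_linorder)
  have upper: "r \<le> C * cmod z * exp (- t * Re z)"
    if t: "t \<ge> t\<^sub>0" "t \<ge> 0" and z: "z \<in> \<sigma>" and r: "r \<ge> 0" "M r \<le> c * t" for t z r
  \<comment> \<open>For \<open>r > 0\<close> the right inverse is positive, so its reciprocal is not
    the default \<open>1 / 0 = 0\<close>.\<close>
  proof (cases "r = 0")
    case True
    then show ?thesis using C by simp
  next
    case False
    define i where "i = right_inverse 0 M (c * t)"
    \<comment> \<open>Divergence of \<open>M\<close> bounds the set defining the right inverse, so
      its \<open>Sup\<close> is a true supremum.\<close>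
    obtain b where b: "\<And>x. x \<ge> b \<Longrightarrow> M x > c * t"
      using lim by (auto simp: filterlim_at_top_dense eventually_at_top_linorder)
    have "x \<le> b" if "M x \<le> c * t" for x
      using b[of x] that by (cases "b \<le> x") auto
    then have "bdd_above {r. 0 \<le> r \<and> M r \<le> c * t}"
      by (intro bdd_aboveI[of _ b]) auto
    then have ri: "r \<le> i"
      unfolding i_def right_inverse_def using r by (intro cSup_upper) auto
    then have i: "i > 0" using False r by linarith
    have zpos: "cmod z > 0" using z nz by auto
    have "exp (t * Re z) / cmod z = cmod (exp (of_real t * z) / z)"
      by (simp add: norm_divide)
    also have "\<dots> \<le> C * norm (1 / i)"
      using B[OF t(2) z] t0[OF t(1)] by (simp add: i_def)
    finally have "exp (t * Re z) / cmod z \<le> C / i" using i by simp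
    then have "i * exp (t * Re z) \<le> C * cmod z"
      using i zpos by (simp add: field_simps)
    then have "i * exp (t * Re z) * exp (- t * Re z) \<le> C * cmod z * exp (- t * Re z)"
      by (rule mult_right_mono) simp
    then have "i \<le> C * cmod z * exp (- t * Re z)"
      by (simp add: mult.assoc flip: exp_add)
    with ri show ?thesis by simp
  qed
  have near: "\<exists>z\<in>\<sigma>. cmod z \<le> s + 3 / (\<delta> * M s) \<and> - Re z \<le> 3 / (\<delta> * M s)" if s: "s \<ge> 0" for s
  proof -
    let ?f = "\<lambda>r. 1 / infdist (\<i> * complex_of_real r) \<sigma>"
    have \<delta>M: "\<delta> * M s > 0" using \<delta> pos[OF s] by simp
    \<comment> \<open>The supremum may not be attained, but half of its lower bound is exceeded at
      some \<open>r\<close>.\<close>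
    have "\<exists>r. \<bar>r\<bar> \<le> s \<and> ?f r > \<delta> * M s / 2"
    proof (rule ccontr)
      assume "\<not> ?thesis"
      then have "\<And>r. \<bar>r\<bar> \<le> s \<Longrightarrow> ?f r \<le> \<delta> * M s / 2" by (meson not_le)
      then have "(SUP r\<in>{r. \<bar>r\<bar> \<le> s}. ?f r) \<le> \<delta> * M s / 2"
        using s by (intro cSUP_least) (auto intro!: exI[of _ 0])
      then show False using low[OF s] \<delta>M by linarith
    qed
    then obtain r where r: "\<bar>r\<bar> \<le> s" "?f r > \<delta> * M s / 2" by blast
    \<comment> \<open>Positivity excludes the default \<open>1 / 0 = 0\<close>, and with it an empty
      spectrum, whose \<open>infdist\<close> is 0. The distance is then below
      \<open>2 / (\<delta> * M s)\<close>; the constant 3 leaves room.\<close>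
    then have "?f r > 0" using \<delta>M by linarith
    then have ip: "infdist (\<i> * complex_of_real r) \<sigma> > 0" by simp
    then have "\<sigma> \<noteq> {}" by (auto simp: infdist_def)
    have "infdist (\<i> * complex_of_real r) \<sigma> < 3 / (\<delta> * M s)"
      using r(2) ip \<delta>M by (simp add: field_simps)
    then obtain z where z: "z \<in> \<sigma>" "dist (\<i> * complex_of_real r) z < 3 / (\<delta> * M s)"
      using infdist_notempty[OF \<open>\<sigma> \<noteq> {}\<close>] \<open>\<sigma> \<noteq> {}\<close>
      by (metis (mono_tags, lifting) cINF_less_iff bdd_below_image_dist)
    have "cmod z \<le> cmod (\<i> * complex_of_real r) + cmod (z - \<i> * complex_of_real r)"
      by (metis add.commute diff_add_cancel norm_triangle_ineq)
    moreover have "- Re z \<le> cmod (\<i> * complex_of_real r - z)"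
      using complex_Re_le_cmod[of "\<i> * complex_of_real r - z"] by simp
    ultimately show ?thesis
      using z r(1) by (intro bexI[of _ z]) (auto simp: dist_norm norm_minus_commute norm_mult)
  qed
  \<comment> \<open>\<open>C\<close> comes from the decay bound, 2 from
    \<open>cmod z \<le> 2 * s\<close>, and the exponential bounds \<open>exp (- t * Re z)\<close>;
    adding 2 gives \<open>L > 1\<close> and a strict final inequality.\<close>
  define L where "L = 2 * C * exp (6 / (c * \<delta>)) + 2"
  obtain b where b: "\<And>s. s \<ge> b \<Longrightarrow> max 1 (c * t\<^sub>0) \<le> M s"
    using lim unfolding filterlim_at_top eventually_at_top_linorder by blast
  \<comment> \<open>From here on \<open>3 / (\<delta> * M s) \<le> 3 / \<delta> \<le> s\<close>, and
    the time chosen below is at least \<open>t\<^sub>0\<close>.\<close>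
  define s\<^sub>0 where "s\<^sub>0 = max b (max 1 (3 / \<delta>))"
  show ?thesis
  proof (rule positive_increase_of_doubling[OF mono pos])
    show "L > 1" using C by (simp add: L_def add_pos_pos)
    show "s\<^sub>0 > 0" by (simp add: s\<^sub>0_def)
    fix s assume "s \<ge> s\<^sub>0"
    then have s: "s \<ge> 1" "s \<ge> 3 / \<delta>" "M s \<ge> 1" "M s \<ge> c * t\<^sub>0"
      using b[of s] by (auto simp: s\<^sub>0_def)
    obtain z where z: "z \<in> \<sigma>" "cmod z \<le> s + 3 / (\<delta> * M s)" "- Re z \<le> 3 / (\<delta> * M s)"
      using near[of s] s by auto
    \<comment> \<open>With \<open>c * t = 2 * M s\<close>, the factor \<open>M s\<close> cancels in
      the bound on \<open>- t * Re z\<close>, leaving a constant independent of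
      \<open>s\<close>.\<close>
    define t where "t = 2 * M s / c"
    have t: "0 \<le> t" "c * t = 2 * M s" using s c by (auto simp: t_def)
    then have "c * t\<^sub>0 \<le> c * t" using s by linarith
    then have "t\<^sub>0 \<le> t" using c by (simp only: mult_le_cancel_left_pos)
    note t = this t
    have "3 / (\<delta> * M s) \<le> 3 / \<delta>"
      using \<delta> s by (intro divide_left_mono) auto
    then have zs: "cmod z \<le> 2 * s" using z s by linarith
    have "- t * Re z \<le> t * (3 / (\<delta> * M s))"
      using mult_left_mono[OF z(3) t(2)] by simp
    also have "\<dots> = 6 / (c * \<delta>)" using \<delta> c s by (simp add: t_def field_simps)
    finally have ex: "exp (- t * Re z) \<le> exp (6 / (c * \<delta>))" by simp
    show "2 * M s \<le> M (L * s)"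
    \<comment> \<open>If doubling failed, \<open>M (L * s) < c * t\<close> would allow
      \<open>r = L * s\<close> in \<open>upper\<close>, bounding \<open>L * s\<close> by a quantity
      smaller than itself.\<close>
    proof (rule ccontr)
      assume "\<not> ?thesis"
      moreover have Ls: "L * s \<ge> 0" using C s by (simp add: L_def)
      ultimately have "L * s \<le> C * cmod z * exp (- t * Re z)"
        using t by (intro upper z) auto
      also have "\<dots> \<le> C * (2 * s) * exp (6 / (c * \<delta>))"
        using C zs ex s by (intro mult_mono) auto
      also have "\<dots> < L * s" using s by (simp add: L_def field_simps)
      finally show False by simp
    qed
  qed
qed

theorem theorem3p4:
  fixes T :: "real \<Rightarrow> 'a::complex_banach \<Rightarrow> 'a"
    and D :: "'a set" and A :: "'a \<Rightarrow> 'a"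
    and M :: "real \<Rightarrow> real" and \<delta> c :: real
  assumes "C0_semigroup T"
    and "is_generator D A T"
    and "spectrum D A \<subseteq> {z. Re z < 0}"
    and "\<And>s. s \<ge> 0 \<Longrightarrow> M s > 0"
    and "continuous_on {0..} M"
    and "mono_on {0..} M"
    and "filterlim M at_top at_top"
    and "0 < \<delta>" and "\<delta> \<le> 1"
    and "\<And>s. s \<ge> 0 \<Longrightarrow>
      \<delta> * M s \<le> (SUP r\<in>{r. \<bar>r\<bar> \<le> s}. 1 / infdist (\<i> * complex_of_real r) (spectrum D A))"
    and "\<And>s. s \<ge> 0 \<Longrightarrow>
      (SUP r\<in>{r. \<bar>r\<bar> \<le> s}. 1 / infdist (\<i> * complex_of_real r) (spectrum D A))
        \<le> (SUP r\<in>{r. \<bar>r\<bar> \<le> s}. onorm (resolvent D A (\<i> * complex_of_real r)))"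
    and "\<And>s. s \<ge> 0 \<Longrightarrow>
      (SUP r\<in>{r. \<bar>r\<bar> \<le> s}. onorm (resolvent D A (\<i> * complex_of_real r))) \<le> M s"
    and "c > 0"
    and "(\<lambda>t. onorm (T t \<circ> op_inverse D A)) \<in> O[at_top](\<lambda>t. 1 / right_inverse 0 M (c * t))"
  shows "positive_increase 0 M"
proof (rule positive_increase_of_spectrum)
  \<comment> \<open>The open left half-plane omits 0, so the generator has a bounded
    inverse.\<close>
  have zero: "0 \<notin> spectrum D A" using assms(3) by auto
  then show "0 \<notin> spectrum D A" .
  show "cmod (exp (of_real t * z) / z) \<le> onorm (T t \<circ> op_inverse D A)"
    if "t \<ge> 0" "z \<in> spectrum D A" for t z
    by (rule spectral_inclusion[OF assms(1,2) zero that(2,1)])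
qed (fact assms)+

end
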